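(* Let $X$ be a random vector in $\mathbb{R}^n$ with law $\mu$, where the support of $\mu$ is not included in a hyperplane and $\Lambda_\mu$ is essentially smooth. Let $f:\mathbb{R}^n\to\mathbb{R}$ be a measurable function and define, for all $t\in\mathbb{R}$, $$\phi(t)=\inf\{\Lambda^*_\mu(y): f(y)\ge t,\ y\in\mathbb{R}^n\}.$$ Let $t,\delta>0$ and assume that $\phi$ is strictly increasing on $[t-\delta,+\infty)$. Let $\kappa\ge\phi(t-\delta)$ be such that, denoting $K=\{\Lambda^*_\mu\le\kappa\}$, $$\mathbb{P}(X\notin K)\le e^{-\phi(t-\delta)}.$$ Let $W\subset\mathbb{R}^n$ be a compact convex set such that $$\forall x,y\in K,\quad f(x)-f(y)\le\sup_{\lambda\in W}\langle\lambda,x-y\rangle .$$ Denote by $D$ the ($\ell^2$-)diameter of $K$ and let $\mathcal{D}_{\delta/2}$ be a $\delta/(2D)$-net of $W$ for the $\ell^2$-norm. Then $$\log\mathbb{P}\big(f(X)\ge t\big)\le-\phi(t-\delta)+\log|\mathcal{D}_{\delta/2}|+\log\Big(\Big(\frac{\kappa LD}{\delta}\Big)\vee1\Big)+2,$$ where $L=\sup_{\lambda\in W}\|\lambda\|_{\ell^2}$.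
   Context: The logarithmic Laplace transform of $\mu$ is $\Lambda_\mu(\lambda)=\log\int e^{\langle\lambda,x\rangle}d\mu(x)$, $\lambda\in\mathbb{R}^n$, and its Legendre transform is $\Lambda^*_\mu(x)=\sup_{\lambda\in\mathbb{R}^n}\{\langle\lambda,x\rangle-\Lambda_\mu(\lambda)\}\in[0,+\infty]$. A convex function $\Lambda:\mathbb{R}^n\to\mathbb{R}\cup\{+\infty\}$ with domain $\mathcal{D}_\Lambda=\{\Lambda<+\infty\}$ is essentially smooth if $\mathrm{int}(\mathcal{D}_\Lambda)$ is non-empty, $\Lambda$ is differentiable on $\mathrm{int}(\mathcal{D}_\Lambda)$, and $\Lambda$ is steep: for any sequence $\lambda_k\in\mathrm{int}(\mathcal{D}_\Lambda)$ converging to a point of the boundary of $\mathcal{D}_\Lambda$, $\|\nabla\Lambda(\lambda_k)\|\to+\infty$. An $\varepsilon$-net of a set $A$ is a finite set of points such that every point of $A$ is at distance at most $\varepsilon$ from some point of the set. Conventions: $\inf\emptyset=+\infty$, $a\vee b=\max(a,b)$, $\log 0=-\infty$. *)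

theory Defs
  imports "HOL-Probability.Probability"
begin

text \<open>The logarithm \<open>[0, \<infinity>] \<rightarrow> [-\<infinity>, \<infinity>]\<close>, with \<open>log 0 = -\<infinity>\<close>. It is only applied to nonnegative
  arguments; negative ones are mapped to \<open>-\<infinity>\<close>.\<close>

definition elog :: "ereal \<Rightarrow> ereal" where
  "elog x = (if x \<le> 0 then -\<infinity> else if x = \<infinity> then \<infinity> else ereal (ln (real_of_ereal x)))"

definition measure_support :: "'a::topological_space measure \<Rightarrow> 'a set" where
  "measure_support \<mu> = {x. \<forall>U. open U \<and> x \<in> U \<longrightarrow> emeasure \<mu> U > 0}"

definition in_some_hyperplane :: "'a::real_inner set \<Rightarrow> bool" where
  "in_some_hyperplane S \<longleftrightarrow> (\<exists>a b. a \<noteq> 0 \<and> S \<subseteq> {x. a \<bullet> x = b})"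

definition log_laplace :: "'a::euclidean_space measure \<Rightarrow> 'a \<Rightarrow> ereal" where
  "log_laplace \<mu> \<theta> = elog (enn2ereal (\<integral>\<^sup>+ x. ennreal (exp (\<theta> \<bullet> x)) \<partial>\<mu>))"

definition legendre :: "('a::real_inner \<Rightarrow> ereal) \<Rightarrow> 'a \<Rightarrow> ereal" where
  "legendre \<Lambda> x = (SUP \<theta>. ereal (\<theta> \<bullet> x) - \<Lambda> \<theta>)"

definition eff_domain :: "('a \<Rightarrow> ereal) \<Rightarrow> 'a set" where
  "eff_domain \<Lambda> = {\<theta>. \<Lambda> \<theta> < \<infinity>}"

definition gradient :: "('a::real_inner \<Rightarrow> real) \<Rightarrow> 'a \<Rightarrow> 'a" where
  "gradient g x = (THE v. GDERIV g x :> v)"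

text \<open>This is meant for convex functions with values in \<open>(-\<infinity>, \<infinity>]\<close>; neither convexity nor
  \<open>\<Lambda> > -\<infinity>\<close> is repeated in the definition, since both always hold for the logarithmic Laplace
  transform of a probability measure.\<close>

definition essentially_smooth :: "('a::euclidean_space \<Rightarrow> ereal) \<Rightarrow> bool" where
  "essentially_smooth \<Lambda> \<longleftrightarrow>
     interior (eff_domain \<Lambda>) \<noteq> {} \<and>
     (\<forall>\<theta>\<in>interior (eff_domain \<Lambda>). (\<lambda>x. real_of_ereal (\<Lambda> x)) differentiable (at \<theta>)) \<and>
     (\<forall>s p. (\<forall>k::nat. s k \<in> interior (eff_domain \<Lambda>)) \<and> p \<in> frontier (eff_domain \<Lambda>) \<and> s \<longlonglongrightarrow> p \<longrightarrow>
        filterlim (\<lambda>k. norm (gradient (\<lambda>x. real_of_ereal (\<Lambda> x)) (s k))) at_top sequentially)"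

text \<open>The function \<open>\<phi>\<close>; in \<^typ>\<open>ereal\<close>, the infimum of the empty set is \<open>\<infinity>\<close>.\<close>

definition level_rate :: "'a::euclidean_space measure \<Rightarrow> ('a \<Rightarrow> real) \<Rightarrow> real \<Rightarrow> ereal" where
  "level_rate \<mu> f t = (INF y\<in>{y. f y \<ge> t}. legendre (log_laplace \<mu>) y)"

text \<open>The library's \<^const>\<open>diameter\<close> is meaningless on unbounded sets, but the sublevel sets of the
  Legendre transform can be unbounded (when \<open>0\<close> is not interior to the domain of \<open>\<Lambda>\<close>).\<close>

definition ediameter :: "'a::metric_space set \<Rightarrow> ereal" where
  "ediameter S = (if bounded S then ereal (diameter S) else \<infinity>)"

text \<open>The points of a net of \<open>A\<close> need not lie in \<open>A\<close>. The radius is extended so that \<open>\<delta> / (2 D)\<close> is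
  \<open>\<infinity>\<close> for \<open>D = 0\<close> and \<open>0\<close> for \<open>D = \<infinity>\<close>.\<close>

definition is_net :: "ereal \<Rightarrow> 'a::metric_space set \<Rightarrow> 'a set \<Rightarrow> bool" where
  "is_net \<epsilon> A N \<longleftrightarrow> finite N \<and> (\<forall>a\<in>A. \<exists>p\<in>N. ereal (dist a p) \<le> \<epsilon>)"

end

theory Submission
  imports Defs
begin

text \<open>Let \<open>\<alpha> = \<phi>(t - \<delta>)\<close>. If \<open>\<mu>(E) > 0\<close> for a bounded closed convex \<open>E\<close>, then the barycentre \<open>y\<close> of
  \<open>\<mu>\<close> conditioned on \<open>E\<close> lies in \<open>E\<close>, and Jensen's inequality gives \<open>\<Lambda>*(y) \<le> - log \<mu>(E)\<close>. Hence every
  closed convex set disjoint from \<open>{\<Lambda>* < \<alpha>}\<close> has mass at most \<open>exp (- \<alpha>)\<close>. If \<open>x \<in> K\<close> and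
  \<open>f x \<ge> t\<close>, then \<open>sup\<^sub>W \<langle>\<theta>, x - y\<rangle> \<ge> \<delta>\<close> for every \<open>y\<close> with \<open>\<Lambda>*(y) < \<alpha>\<close>; since this set of \<open>y\<close> is
  convex, a minimax argument yields one \<open>\<theta> \<in> W\<close> that works for all of them, and a nearby point of the
  net still gives \<open>\<delta> / 2\<close>. So, up to the event \<open>X \<notin> K\<close>, the event \<open>f X \<ge> t\<close> is covered by
  as many convex sets of mass at most \<open>exp (- \<alpha>)\<close> as the net has points. The bound obtained is
  \<open>(1 + |N|) exp (- \<alpha>)\<close>.\<close>

section \<open>Sublevel sets of a Legendre transform\<close>

lemma ereal_minus_le_iff_add:
  fixes a b :: real and L :: ereal
  shows "ereal a - L \<le> ereal b \<longleftrightarrow> ereal (a - b) \<le> L"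
  by (cases L) auto

text \<open>Turns a finite level into one affine inequality in \<open>x\<close> for each \<theta>,
  so that sublevel sets become intersections of half-spaces, empty sets and whole spaces.\<close>

lemma legendre_le_iff:
  "legendre \<Lambda> x \<le> ereal b \<longleftrightarrow> (\<forall>\<theta>. ereal (\<theta> \<bullet> x - b) \<le> \<Lambda> \<theta>)"
  by (simp add: legendre_def SUP_le_iff ereal_minus_le_iff_add)

lemma closed_legendre_sublevel:
  fixes \<Lambda> :: "'a::real_inner \<Rightarrow> ereal"
  shows "closed {x. legendre \<Lambda> x \<le> ereal b}"
proof -
  have eq: "{x. legendre \<Lambda> x \<le> ereal b} = (\<Inter>\<theta>. {x. ereal (\<theta> \<bullet> x - b) \<le> \<Lambda> \<theta>})"
    by (auto simp: legendre_le_iff)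
  have "closed {x. ereal (\<theta> \<bullet> x - b) \<le> \<Lambda> \<theta>}" for \<theta>
    by (intro closed_Collect_le continuous_intros)
  then show ?thesis
    unfolding eq by (intro closed_INT) auto
qed

lemma convex_legendre_sublevel:
  fixes \<Lambda> :: "'a::real_inner \<Rightarrow> ereal"
  shows "convex {x. legendre \<Lambda> x \<le> ereal b}"
proof -
  have eq: "{x. legendre \<Lambda> x \<le> ereal b} = (\<Inter>\<theta>. {x. ereal (\<theta> \<bullet> x - b) \<le> \<Lambda> \<theta>})"
    by (auto simp: legendre_le_iff)
  have "convex {x. ereal (\<theta> \<bullet> x - b) \<le> \<Lambda> \<theta>}" for \<theta>
  proof (cases "\<Lambda> \<theta>")
    case (real r)
    then have "{x. ereal (\<theta> \<bullet> x - b) \<le> \<Lambda> \<theta>} = {x. \<theta> \<bullet> x \<le> b + r}"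
      by (auto simp: algebra_simps)
    then show ?thesis by (simp add: convex_halfspace_le)
  qed auto
  then show ?thesis
    unfolding eq by (intro convex_INT) auto
qed

text \<open>A strict sublevel set is the increasing union of the non-strict ones below it: two of
  its points share a level \<open>b < a\<close>, where convexity is already known.\<close>

lemma convex_legendre_strict_sublevel:
  fixes \<Lambda> :: "'a::real_inner \<Rightarrow> ereal"
  shows "convex {x. legendre \<Lambda> x < ereal a}"
proof (rule convexI)
  fix x y :: 'a and u v :: real
  assume *: "x \<in> {x. legendre \<Lambda> x < ereal a}" "y \<in> {x. legendre \<Lambda> x < ereal a}"
    "0 \<le> u" "0 \<le> v" "u + v = 1"
  then have "max (legendre \<Lambda> x) (legendre \<Lambda> y) < ereal a" by simp
  then obtain b where b: "max (legendre \<Lambda> x) (legendre \<Lambda> y) < ereal b" "ereal b < ereal a"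
    using ereal_dense2 by blast
  then have "legendre \<Lambda> x \<le> ereal b" "legendre \<Lambda> y \<le> ereal b" by auto
  then have "legendre \<Lambda> (u *\<^sub>R x + v *\<^sub>R y) \<le> ereal b"
    using convexD[OF convex_legendre_sublevel, of x \<Lambda> b y u v] * by simp
  then show "u *\<^sub>R x + v *\<^sub>R y \<in> {x. legendre \<Lambda> x < ereal a}"
    using b(2) by (simp add: order.strict_trans1)
qed

section \<open>A minimax argument by separation\<close>

text \<open>The separation takes place between \<open>Z \<times> {c}\<close> and the strict epigraph of the support
  function of \<open>W\<close>; separating in the original space would only place the maximizer in the
  convex hull of \<open>W \<union> {0}\<close>.\<close>

lemma common_maximizer:
  fixes W Z :: "'a::euclidean_space set"
  assumes "compact W" "convex W" "W \<noteq> {}" "convex Z"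
    and ex: "\<And>z. z \<in> Z \<Longrightarrow> \<exists>\<theta>\<in>W. c \<le> \<theta> \<bullet> z"
  shows "\<exists>\<theta>\<in>W. \<forall>z\<in>Z. c \<le> \<theta> \<bullet> z"
proof (cases "Z = {}")
  case True
  then show ?thesis using assms by auto
next
  case False
  define B where "B = {p :: 'a \<times> real. \<forall>\<theta>\<in>W. \<theta> \<bullet> fst p < snd p}"
  obtain R where R: "\<And>\<theta>. \<theta> \<in> W \<Longrightarrow> norm \<theta> \<le> R" "R \<ge> 0"
    using compact_imp_bounded[OF \<open>compact W\<close>] bounded_pos by (metis less_imp_le)
  have Bscale: "k *\<^sub>R p \<in> B" if "p \<in> B" "k > 0" for k p
    using that by (auto simp: B_def)
  \<comment> \<open>Every \<open>u\<close> is the first component of a point of \<open>B\<close>;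
    this later rules out a vertical hyperplane.\<close>
  have inB: "(u, R * norm u + 1) \<in> B" for u
  proof -
    have "\<theta> \<bullet> u < R * norm u + 1" if "\<theta> \<in> W" for \<theta>
      using norm_cauchy_schwarz[of \<theta> u] mult_right_mono[OF R(1)[OF that], of "norm u"] by auto
    then show ?thesis by (simp add: B_def)
  qed
  have "convex B"
  proof (rule convexI)
    fix x y :: "'a \<times> real" and u v :: real
    assume *: "x \<in> B" "y \<in> B" "0 \<le> u" "0 \<le> v" "u + v = 1"
    have "\<theta> \<bullet> fst (u *\<^sub>R x + v *\<^sub>R y) < snd (u *\<^sub>R x + v *\<^sub>R y)" if "\<theta> \<in> W" for \<theta>
    proof -
      have "u * (\<theta> \<bullet> fst x) + v * (\<theta> \<bullet> fst y) < u * snd x + v * snd y"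
      proof (cases "u = 0")
        case True
        then show ?thesis using * that by (auto simp: B_def)
      next
        case False
        then have "u * (\<theta> \<bullet> fst x) < u * snd x"
          using * that by (auto simp: B_def)
        moreover have "v * (\<theta> \<bullet> fst y) \<le> v * snd y"
          using * that by (intro mult_left_mono) (auto simp: B_def less_imp_le)
        ultimately show ?thesis by linarith
      qed
      then show ?thesis by (simp add: inner_right_distrib)
    qed
    then show "u *\<^sub>R x + v *\<^sub>R y \<in> B" by (simp add: B_def)
  qed
  moreover have "convex (Z \<times> {c})"
    using \<open>convex Z\<close> by (intro convex_Times) auto
  moreover have "B \<inter> (Z \<times> {c}) = {}"
    using ex by (force simp: B_def)
  moreover have "B \<noteq> {}" using inB by blast
  moreover have "Z \<times> {c} \<noteq> {}" using False by auto
  ultimately obtain a b where ab: "a \<noteq> 0" "\<forall>p\<in>B. a \<bullet> p \<le> b" "\<forall>p\<in>Z \<times> {c}. a \<bullet> p \<ge> b"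
    using separating_hyperplane_sets[of B "Z \<times> {c}"] by blast
  obtain v s where vs: "a = (v, s)" by (cases a)
  \<comment> \<open>\<open>B\<close> is stable under positive scaling, so a linear functional
    bounded above on it is nonpositive there: \<open>k\<close> scales a positive value up to |b| +
    1, above \<open>b\<close>.\<close>
  have B0: "a \<bullet> p \<le> 0" if "p \<in> B" for p
  proof (rule ccontr)
    assume "\<not> a \<bullet> p \<le> 0"
    then have pos: "a \<bullet> p > 0" by simp
    define k where "k = (\<bar>b\<bar> + 1) / (a \<bullet> p)"
    have "k > 0" using pos by (simp add: k_def)
    then have "k * (a \<bullet> p) \<le> b" using ab(2) Bscale[OF that] by fastforce
    then show False using pos by (simp add: k_def)
  qed
  \<comment> \<open>The points \<open>(0, e)\<close> of \<open>B\<close> approach the origin, where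
    the functional vanishes, so \<open>b\<close> cannot be negative; this \<open>e\<close> keeps
    \<open>s * e\<close> at \<open>b / 2\<close> or more.\<close>
  have b0: "b \<ge> 0"
  proof (rule ccontr)
    assume neg: "\<not> b \<ge> 0"
    define e where "e = - b / (2 * (\<bar>s\<bar> + 1))"
    have "e > 0" using neg unfolding e_def by (intro divide_pos_pos) auto
    then have "(0, e) \<in> B" by (simp add: B_def)
    then have "s * e \<le> b" using ab(2) vs by fastforce
    moreover have "\<bar>s\<bar> * e \<le> - b / 2"
    proof -
      have "\<bar>s\<bar> * e \<le> (\<bar>s\<bar> + 1) * e" using \<open>e > 0\<close> by (intro mult_right_mono) auto
      also have "\<dots> = - b / 2" by (simp add: e_def field_simps add_nonneg_eq_0_iff)
      finally show ?thesis .
    qed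
    moreover have "- (\<bar>s\<bar> * e) \<le> s * e"
      using \<open>e > 0\<close> by (simp add: abs_if)
    ultimately show False using neg by linarith
  qed
  have "s \<le> 0"
    using B0[of "(0, 1)"] by (simp add: vs B_def)
  moreover have "s \<noteq> 0"
  proof
    assume "s = 0"
    then have "v \<bullet> v \<le> 0" using B0[OF inB[of v]] by (simp add: vs)
    then have "v = 0" by (metis inner_gt_zero_iff not_less)
    then show False using ab(1) vs \<open>s = 0\<close> by (simp add: zero_prod_def)
  qed
  ultimately have s: "s < 0" by simp
  \<comment> \<open>Divided by \<open>- s\<close>, the normal \<open>a\<close> becomes
    \<open>(w, - 1)\<close>: on \<open>B\<close> it puts \<open>w\<close> below the support function
    of \<open>W\<close>, on \<open>Z\<close> it gives the wanted lower bound.\<close>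
  define w where "w = (1 / (- s)) *\<^sub>R v"
  have v: "v = (- s) *\<^sub>R w" using s by (simp add: w_def)
  have wB: "w \<bullet> u \<le> r" if "(u, r) \<in> B" for u r
  proof -
    have "s * (r - w \<bullet> u) \<le> 0" using B0[OF that] by (simp add: vs v algebra_simps)
    then show ?thesis using s by (simp add: mult_le_0_iff)
  qed
  have wZ: "c \<le> w \<bullet> z" if "z \<in> Z" for z
  proof -
    have "b \<le> s * (c - w \<bullet> z)" using ab(3) that by (auto simp: vs v algebra_simps)
    then have "0 \<le> s * (c - w \<bullet> z)" using b0 by linarith
    then show ?thesis using s by (simp add: zero_le_mult_iff)
  qed
  \<comment> \<open>A linear form below the support function of a closed convex set comes from a
    point of that set: otherwise a separating \<open>d\<close>, with its sign reversed, yields a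
    point of \<open>B\<close> that violates \<open>wB\<close>.\<close>
  have "w \<in> W"
  proof (rule ccontr)
    assume "w \<notin> W"
    then obtain d e where de: "d \<bullet> w < e" "\<forall>x\<in>W. d \<bullet> x > e"
      using separating_hyperplane_closed_point[of W w] assms compact_imp_closed by blast
    then have "(- d, - e) \<in> B" by (auto simp: B_def inner_commute)
    then show False using wB de by (force simp: inner_commute)
  qed
  then show ?thesis using wZ by blast
qed

section \<open>Mass of convex sets\<close>

text \<open>The witness is the barycentre of \<open>\<mu>\<close> conditioned on \<open>E\<close>.\<close>

lemma exists_legendre_le_neg_ln_measure:
  fixes \<mu> :: "'a::euclidean_space measure"
  assumes "prob_space \<mu>" and sets: "sets \<mu> = sets borel"
    and E: "closed E" "convex E" "bounded E" and pos: "measure \<mu> E > 0"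
  shows "\<exists>y\<in>E. legendre (log_laplace \<mu>) y \<le> ereal (- ln (measure \<mu> E))"
proof -
  interpret prob_space \<mu> by fact
  define p where "p = measure \<mu> E"
  have p: "p > 0" using pos by (simp add: p_def)
  have Em [measurable]: "E \<in> sets \<mu>" using E by (simp add: sets)
  obtain R where R: "\<And>x. x \<in> E \<Longrightarrow> norm x \<le> R"
    using E(3) bounded_iff by blast
  have [measurable]: "(\<lambda>x. x) \<in> borel_measurable \<mu>"
    using sets by (simp add: measurable_ident_sets)
  have int: "set_integrable \<mu> E (\<lambda>x. x)"
    unfolding set_integrable_def
    by (rule integrable_const_bound[where B = "\<bar>R\<bar>"])
       (use R in \<open>auto intro!: AE_I2 split: split_indicator dest: order_trans[OF _ abs_ge_self]\<close>)
  have inti: "set_integrable \<mu> E (\<lambda>x. a \<bullet> x)" for a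
    using integrable_inner_right[of a, OF int[unfolded set_integrable_def]]
    by (simp add: set_integrable_def)
  have intc: "set_integrable \<mu> E (\<lambda>x. c)" for c :: real
    unfolding set_integrable_def using Em by (simp add: emeasure_eq_measure)
  define y where "y = (1 / p) *\<^sub>R (LINT x:E|\<mu>. x)"
  have inner_y: "(LINT x:E|\<mu>. a \<bullet> x) = p * (a \<bullet> y)" for a
  proof -
    have "(LINT x:E|\<mu>. a \<bullet> x) = a \<bullet> (LINT x:E|\<mu>. x)"
      using integral_inner_right[of a, OF int[unfolded set_integrable_def]]
      by (simp add: set_lebesgue_integral_def)
    then show ?thesis using p by (simp add: y_def)
  qed
  have const: "(LINT x:E|\<mu>. c) = p * c" for c :: real
    by (simp add: set_lebesgue_integral_def p_def)
  \<comment> \<open>A hyperplane strictly separating \<open>y\<close> from \<open>E\<close> would,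
    after averaging over \<open>E\<close>, separate \<open>y\<close> from itself.\<close>
  have "y \<in> E"
  proof (rule ccontr)
    assume "y \<notin> E"
    then obtain a b where ab: "a \<bullet> y < b" "\<forall>x\<in>E. a \<bullet> x > b"
      using separating_hyperplane_closed_point[of E y] E by blast
    have "(LINT x:E|\<mu>. b) \<le> (LINT x:E|\<mu>. a \<bullet> x)"
      by (intro set_integral_mono intc inti) (use ab in \<open>auto intro: less_imp_le\<close>)
    then have "p * b \<le> p * (a \<bullet> y)" by (simp only: inner_y const)
    then show False using p ab by simp
  qed
  moreover have "legendre (log_laplace \<mu>) y \<le> ereal (- ln p)"
    unfolding legendre_le_iff
  proof
    fix \<theta>
    define I where "I = (\<integral>\<^sup>+ x. ennreal (exp (\<theta> \<bullet> x)) \<partial>\<mu>)"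
    define c where "c = exp (\<theta> \<bullet> y)"
    \<comment> \<open>Jensen's inequality by hand: this is the tangent line of the exponential at
      the barycentre. Its linear part averages out over \<open>E\<close>, leaving
      \<open>p * c\<close>, which is therefore at most \<open>I\<close>; logarithms then give the
      claim.\<close>
    have tangent: "c * (1 - \<theta> \<bullet> y) + c * (\<theta> \<bullet> x) \<le> exp (\<theta> \<bullet> x)" for x
    proof -
      have "c * (1 + (\<theta> \<bullet> x - \<theta> \<bullet> y)) \<le> c * exp (\<theta> \<bullet> x - \<theta> \<bullet> y)"
        by (intro mult_left_mono exp_ge_add_one_self) (simp add: c_def)
      then show ?thesis by (simp add: c_def exp_diff algebra_simps)
    qed
    have int': "set_integrable \<mu> E (\<lambda>x. c * (\<theta> \<bullet> x))"
      using inti[of "c *\<^sub>R \<theta>"] by simp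
    have "(LINT x:E|\<mu>. c * (1 - \<theta> \<bullet> y) + c * (\<theta> \<bullet> x))
        = (LINT x:E|\<mu>. c * (1 - \<theta> \<bullet> y)) + (LINT x:E|\<mu>. c * (\<theta> \<bullet> x))"
      by (intro set_integral_add intc int')
    also have "(LINT x:E|\<mu>. c * (\<theta> \<bullet> x)) = c * (p * (\<theta> \<bullet> y))"
      by (simp add: inner_y)
    also have "(LINT x:E|\<mu>. c * (1 - \<theta> \<bullet> y)) = p * (c * (1 - \<theta> \<bullet> y))"
      by (rule const)
    finally have eq: "(LINT x:E|\<mu>. c * (1 - \<theta> \<bullet> y) + c * (\<theta> \<bullet> x)) = p * c"
      by (simp add: algebra_simps)
    have intl: "integrable \<mu> (\<lambda>x. indicator E x * (c * (1 - \<theta> \<bullet> y) + c * (\<theta> \<bullet> x)))"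
      using set_integral_add(1)[OF intc int'] by (simp add: set_integrable_def)
    have pc: "p * c > 0" using p by (simp add: c_def)
    show "ereal (\<theta> \<bullet> y - - ln p) \<le> log_laplace \<mu> \<theta>"
    proof (cases "I = \<infinity>")
      case True
      then show ?thesis by (simp add: log_laplace_def elog_def I_def[symmetric])
    next
      case False
      then obtain r where r: "I = ennreal r" "r \<ge> 0"
        by (cases I) auto
      have "integrable \<mu> (\<lambda>x. exp (\<theta> \<bullet> x))"
        using False by (intro integrableI_nonneg) (auto simp: I_def top.not_eq_extremum)
      moreover from this have "(LINT x|\<mu>. exp (\<theta> \<bullet> x)) = r"
        using r nn_integral_eq_integral[of \<mu> "\<lambda>x. exp (\<theta> \<bullet> x)"] by (simp add: I_def)
      moreover have "p * c = (LINT x|\<mu>. indicator E x * (c * (1 - \<theta> \<bullet> y) + c * (\<theta> \<bullet> x)))"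
        using eq by (simp add: set_lebesgue_integral_def)
      moreover have "indicator E x * (c * (1 - \<theta> \<bullet> y) + c * (\<theta> \<bullet> x)) \<le> exp (\<theta> \<bullet> x)" for x
        using tangent[of x] by (cases "x \<in> E") auto
      ultimately have "p * c \<le> r"
        using integral_mono[OF intl, of "\<lambda>x. exp (\<theta> \<bullet> x)"] by simp
      moreover from this have "ln (p * c) \<le> ln r" "r > 0" using pc by auto
      moreover have "ln (p * c) = ln p + \<theta> \<bullet> y" using p by (simp add: ln_mult c_def)
      ultimately show ?thesis
        using r by (simp add: log_laplace_def elog_def I_def[symmetric] enn2ereal_ennreal)
    qed
  qed
  ultimately show ?thesis by (auto simp: p_def)
qed

text \<open>If the mass is positive, the barycentre bound and \<open>lower\<close> meet at a point
  of \<open>E\<close>. The barycentre requires boundedness, so \<open>E\<close> is first cut by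
  balls; continuity from below removes the cut.\<close>

lemma measure_convex_le_exp:
  fixes \<mu> :: "'a::euclidean_space measure"
  assumes "prob_space \<mu>" and sets: "sets \<mu> = sets borel"
    and E: "closed E" "convex E"
    and lower: "\<And>y. y \<in> E \<Longrightarrow> ereal a \<le> legendre (log_laplace \<mu>) y"
  shows "measure \<mu> E \<le> exp (- a)"
proof -
  interpret prob_space \<mu> by fact
  have *: "measure \<mu> (E \<inter> cball 0 (real n)) \<le> exp (- a)" for n
  proof (cases "measure \<mu> (E \<inter> cball 0 (real n)) > 0")
    case True
    then obtain y where y: "y \<in> E"
      "legendre (log_laplace \<mu>) y \<le> ereal (- ln (measure \<mu> (E \<inter> cball 0 (real n))))"
      using exists_legendre_le_neg_ln_measure[of \<mu> "E \<inter> cball 0 (real n)"] assms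
      by (auto simp: convex_Int closed_Int bounded_Int)
    then have "ereal a \<le> ereal (- ln (measure \<mu> (E \<inter> cball 0 (real n))))"
      using lower by (blast intro: order_trans)
    then have "ln (measure \<mu> (E \<inter> cball 0 (real n))) \<le> - a" by simp
    then show ?thesis using True by (metis exp_le_cancel_iff exp_ln)
  next
    case False
    then show ?thesis by (simp add: not_less order_trans[OF _ exp_ge_zero])
  qed
  have "(\<lambda>n. measure \<mu> (E \<inter> cball 0 (real n))) \<longlonglongrightarrow> measure \<mu> (\<Union>n. E \<inter> cball 0 (real n))"
    using E by (intro finite_Lim_measure_incseq) (auto simp: sets incseq_def intro: order_trans)
  moreover have "(\<Union>n. E \<inter> cball 0 (real n)) = E"
    using real_arch_simple by auto
  ultimately show ?thesis using * by (auto intro: LIMSEQ_le_const2)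
qed

section \<open>The deviation bound\<close>

lemma legendre_log_laplace_nonneg:
  assumes "prob_space \<mu>"
  shows "0 \<le> legendre (log_laplace \<mu>) y"
proof -
  interpret prob_space \<mu> by fact
  have "log_laplace \<mu> 0 = 0"
    by (simp add: log_laplace_def elog_def emeasure_space_1 one_ennreal.rep_eq)
  then have "0 \<le> ereal (0 \<bullet> y) - log_laplace \<mu> 0" by simp
  then show ?thesis unfolding legendre_def by (rule SUP_upper2[OF UNIV_I])
qed

lemma elog_le_ln: "0 \<le> x \<Longrightarrow> x \<le> b \<Longrightarrow> 0 < b \<Longrightarrow> elog (ereal x) \<le> ereal (ln b)"
  by (auto simp: elog_def)

lemma elog_nonneg: "1 \<le> x \<Longrightarrow> 0 \<le> elog x"
  by (cases x) (auto simp: elog_def)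

lemma dist_le_ediameter:
  "x \<in> S \<Longrightarrow> y \<in> S \<Longrightarrow> ereal (dist x y) \<le> ediameter S"
  by (simp add: ediameter_def diameter_bounded_bound)

theorem corollary1p8:
  fixes M :: "'w measure"
    and X :: "'w \<Rightarrow> real ^ 'n"
    and \<mu> :: "(real ^ 'n) measure"
    and f :: "real ^ 'n \<Rightarrow> real"
    and \<phi> :: "real \<Rightarrow> ereal"
    and t \<delta> \<kappa> L :: real
    and D :: ereal
    and K W N :: "(real ^ 'n) set"
  assumes "prob_space M"
    and "X \<in> borel_measurable M"
    and "\<mu> = distr M borel X"
    and "\<not> in_some_hyperplane (measure_support \<mu>)"
    and "essentially_smooth (log_laplace \<mu>)"
    and "f \<in> borel_measurable borel"
    and "\<phi> = level_rate \<mu> f"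
    and "t > 0" and "\<delta> > 0"
    and "strict_mono_on {t - \<delta>..} \<phi>"
    and "ereal \<kappa> \<ge> \<phi> (t - \<delta>)"
    and "K = {x. legendre (log_laplace \<mu>) x \<le> ereal \<kappa>}"
    and "\<P>(\<omega> in M. X \<omega> \<notin> K) \<le> exp (- real_of_ereal (\<phi> (t - \<delta>)))"
    and "compact W" and "convex W" and "W \<noteq> {}"
    and "\<forall>x\<in>K. \<forall>y\<in>K. f x - f y \<le> (SUP \<theta>\<in>W. \<theta> \<bullet> (x - y))"
    and "D = ediameter K"
    and "is_net (ereal \<delta> / (2 * D)) W N"
    and "L = (SUP \<theta>\<in>W. norm \<theta>)"
  shows "elog (ereal (\<P>(\<omega> in M. f (X \<omega>) \<ge> t)))
    \<le> - \<phi> (t - \<delta>) + elog (ereal (real (card N)))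
      + elog (max (ereal \<kappa> * ereal L * D / ereal \<delta>) 1) + 2"
proof -
  interpret M: prob_space M by fact
  have X [measurable]: "X \<in> borel_measurable M" by fact
  have [measurable]: "f \<in> borel_measurable borel" by fact
  define \<Lambda> where "\<Lambda> = log_laplace \<mu>"
  have prob\<mu>: "prob_space \<mu>" and sets\<mu>: "sets \<mu> = sets borel"
    using assms(3) by (simp_all add: M.prob_space_distr)
  have "0 \<le> \<phi> (t - \<delta>)"
    unfolding assms(7) level_rate_def
    by (intro INF_greatest legendre_log_laplace_nonneg prob\<mu>)
  \<comment> \<open>The rate lies between 0 and \<kappa>, hence is finite, and
    \<open>real_of_ereal\<close> in the hypothesis on \<open>K\<close> returns its true
    value.\<close>
  then obtain \<alpha> where \<alpha>: "\<phi> (t - \<delta>) = ereal \<alpha>"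
    using assms(11) by (cases "\<phi> (t - \<delta>)") auto
  have "\<alpha> \<le> \<kappa>" using assms(11) \<alpha> by simp
  define K0 where "K0 = {y. legendre \<Lambda> y < ereal \<alpha>}"
  have "convex K0" unfolding K0_def by (rule convex_legendre_strict_sublevel)
  have K_eq: "K = {x. legendre \<Lambda> x \<le> ereal \<kappa>}" using assms(12) by (simp add: \<Lambda>_def)
  then have K: "closed K" "convex K"
    by (simp_all add: closed_legendre_sublevel convex_legendre_sublevel)
  have K0K: "K0 \<subseteq> K"
    unfolding K0_def K_eq using \<open>\<alpha> \<le> \<kappa>\<close> by (auto intro: order_trans[OF less_imp_le])
  have f_K0: "f y < t - \<delta>" if "y \<in> K0" for y
  proof (rule ccontr)
    assume "\<not> f y < t - \<delta>"
    then have "\<phi> (t - \<delta>) \<le> legendre \<Lambda> y"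
      unfolding assms(7) level_rate_def \<Lambda>_def by (intro INF_lower) auto
    then show False using that \<alpha> by (simp add: K0_def)
  qed
  \<comment> \<open>The threshold is half of \<delta> to leave room for replacing a maximizer in
    \<open>W\<close> by a point of the net.\<close>
  define E where "E p = {x\<in>K. \<forall>y\<in>K0. \<delta> / 2 \<le> p \<bullet> (x - y)}" for p
  have E_eq: "E p = K \<inter> (\<Inter>y\<in>K0. {x. p \<bullet> x \<ge> \<delta> / 2 + p \<bullet> y})" for p
    by (auto simp: E_def algebra_simps)
  have E: "closed (E p)" "convex (E p)" for p
    unfolding E_eq using K
    by (auto intro!: closed_Int closed_INT closed_halfspace_ge convex_Int convex_INT convex_halfspace_ge)
  have muE: "measure \<mu> (E p) \<le> exp (- \<alpha>)" for p
  proof (rule measure_convex_le_exp[OF prob\<mu> sets\<mu> E])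
    \<comment> \<open>A point of \<open>K0\<close> in \<open>E p\<close> could be compared with
      itself, giving \<delta> / 2 \<le> 0.\<close>
    fix y assume "y \<in> E p"
    then have "y \<notin> K0" using \<open>\<delta> > 0\<close> by (auto simp: E_def)
    then show "ereal \<alpha> \<le> legendre (log_laplace \<mu>) y" by (simp add: K0_def \<Lambda>_def)
  qed
  have cover: "\<exists>p\<in>N. x \<in> E p" if x: "x \<in> K" "f x \<ge> t" for x
  proof -
    have "\<exists>\<theta>\<in>W. \<forall>z\<in>(\<lambda>y. x - y) ` K0. \<delta> \<le> \<theta> \<bullet> z"
    proof (rule common_maximizer)
      show "convex ((\<lambda>y. x - y) ` K0)"
        using convex_translation[OF convex_negations[OF \<open>convex K0\<close>], of x]
        by (simp add: image_image)
    next
      fix z assume "z \<in> (\<lambda>y. x - y) ` K0"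
      then obtain y where y: "y \<in> K0" "z = x - y" by auto
      have "f x - f y \<le> (SUP \<theta>\<in>W. \<theta> \<bullet> z)" using assms(17) x y K0K by auto
      \<comment> \<open>The strict gap lets some element of \<open>W\<close> exceed \<delta> without
        appeal to attainment of the supremum.\<close>
      then have *: "\<delta> < (SUP \<theta>\<in>W. \<theta> \<bullet> z)" using f_K0[OF y(1)] x by linarith
      have "\<exists>\<theta>\<in>W. \<delta> < \<theta> \<bullet> z"
      proof (rule ccontr)
        assume "\<not> (\<exists>\<theta>\<in>W. \<delta> < \<theta> \<bullet> z)"
        then have "(SUP \<theta>\<in>W. \<theta> \<bullet> z) \<le> \<delta>" using \<open>W \<noteq> {}\<close> by (intro cSUP_least) auto
        then show False using * by simp
      qed
      then show "\<exists>\<theta>\<in>W. \<delta> \<le> \<theta> \<bullet> z" by (auto intro: less_imp_le)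
    qed fact+
    then obtain \<theta> where \<theta>: "\<theta> \<in> W" "\<And>y. y \<in> K0 \<Longrightarrow> \<delta> \<le> \<theta> \<bullet> (x - y)" by auto
    then obtain p where p: "p \<in> N" "ereal (dist \<theta> p) \<le> ereal \<delta> / (2 * D)"
      using assms(19) unfolding is_net_def by blast
    have "\<delta> / 2 \<le> p \<bullet> (x - y)" if y: "y \<in> K0" for y
    proof -
      have ge: "\<delta> \<le> \<theta> \<bullet> (x - y)" using \<theta> y by blast
      then have "x \<noteq> y" using \<open>\<delta> > 0\<close> by auto
      then have pos: "dist x y > 0" by simp
      have D: "ereal (dist x y) \<le> D"
        unfolding assms(18) using x y K0K by (intro dist_le_ediameter) auto
      \<comment> \<open>The cost of passing from \<theta> to \<open>p\<close>: radius times
        diameter. Since \<open>x\<close> and \<open>y\<close> differ, \<open>D\<close> is positive;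
        for infinite \<open>D\<close> the radius is 0 and \<open>p\<close> equals \<theta>.\<close>
      have "dist \<theta> p * dist x y \<le> \<delta> / 2"
      proof (cases D)
        case (real d)
        then have d: "dist x y \<le> d" using D by simp
        then have "d > 0" using pos by linarith
        have "2 * ereal d = ereal (2 * d)"
          by (metis numeral_eq_ereal times_ereal.simps(1))
        then have "dist \<theta> p \<le> \<delta> / (2 * d)"
          using p(2) real \<open>d > 0\<close> by simp
        then have "dist \<theta> p * dist x y \<le> \<delta> / (2 * d) * d"
          using d \<open>d > 0\<close> \<open>\<delta> > 0\<close> by (intro mult_mono) auto
        then show ?thesis using \<open>d > 0\<close> by simp
      next
        case PInf
        then have "dist \<theta> p \<le> 0" using p(2) by simp
        then show ?thesis using \<open>\<delta> > 0\<close> by simp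
      next
        case MInf
        then show ?thesis using D by simp
      qed
      moreover have "(\<theta> - p) \<bullet> (x - y) \<le> dist \<theta> p * dist x y"
        by (simp add: dist_norm norm_cauchy_schwarz)
      ultimately show ?thesis using ge by (simp add: inner_diff_left)
    qed
    then show ?thesis using p(1) x(1) by (auto simp: E_def)
  qed
  have N: "finite N" "N \<noteq> {}"
    using assms(19) \<open>W \<noteq> {}\<close> by (auto simp: is_net_def)
  define P where "P = \<P>(\<omega> in M. f (X \<omega>) \<ge> t)"
  have [measurable]: "K \<in> sets borel" "\<And>p. E p \<in> sets borel" using K E by auto
  have PE: "\<P>(\<omega> in M. X \<omega> \<in> E p) \<le> exp (- \<alpha>)" for p
  proof -
    have "X -` E p \<inter> space M = {\<omega>\<in>space M. X \<omega> \<in> E p}" by auto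
    then show ?thesis using muE[of p] unfolding assms(3) by (simp add: measure_distr)
  qed
  \<comment> \<open>Union bound: one term for leaving \<open>K\<close>, one for each point of the
    net.\<close>
  have "P \<le> measure M ({\<omega>\<in>space M. X \<omega> \<notin> K} \<union> (\<Union>p\<in>N. {\<omega>\<in>space M. X \<omega> \<in> E p}))"
    unfolding P_def using N cover by (intro M.finite_measure_mono sets.Un sets.finite_UN) auto
  also have "\<dots> \<le> \<P>(\<omega> in M. X \<omega> \<notin> K) + measure M (\<Union>p\<in>N. {\<omega>\<in>space M. X \<omega> \<in> E p})"
    using N by (intro measure_Un_le sets.finite_UN) auto
  also have "\<dots> \<le> \<P>(\<omega> in M. X \<omega> \<notin> K) + (\<Sum>p\<in>N. \<P>(\<omega> in M. X \<omega> \<in> E p))"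
    using N by (intro add_left_mono measure_UNION_le) auto
  also have "\<dots> \<le> exp (- \<alpha>) + (\<Sum>p\<in>N. exp (- \<alpha>))"
    using assms(13) \<alpha> by (intro add_mono sum_mono PE) auto
  also have "\<dots> = (1 + real (card N)) * exp (- \<alpha>)" by (simp add: algebra_simps)
  finally have P: "P \<le> (1 + real (card N)) * exp (- \<alpha>)" .
  have n: "real (card N) \<ge> 1" using N by (simp add: Suc_leI card_gt_0_iff)
  \<comment> \<open>As \<open>N\<close> is nonempty, the extra 1 at most doubles the count, and the
    factor 2 is absorbed by \<open>exp 2\<close>, the source of the final summand 2.\<close>
  have "(1 + real (card N)) * exp (- \<alpha>) \<le> (exp 2 * real (card N)) * exp (- \<alpha>)"
  proof (rule mult_right_mono)
    have "1 + real (card N) \<le> 2 * real (card N)" using n by simp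
    also have "\<dots> \<le> exp 2 * real (card N)"
      using exp_ge_add_one_self[of 2] by (intro mult_right_mono) auto
    finally show "1 + real (card N) \<le> exp 2 * real (card N)" .
  qed simp
  with P have "P \<le> exp 2 * real (card N) * exp (- \<alpha>)" by linarith
  then have "elog (ereal P) \<le> ereal (ln (exp 2 * real (card N) * exp (- \<alpha>)))"
    using n by (intro elog_le_ln) (auto simp: P_def)
  also have "ln (exp 2 * real (card N) * exp (- \<alpha>)) = - \<alpha> + ln (real (card N)) + 2"
    using n by (simp add: ln_mult)
  \<comment> \<open>The inserted \<open>0\<close> marks the place of the last logarithm, which is
    nonnegative because of the maximum with 1.\<close>
  also have "ereal (- \<alpha> + ln (real (card N)) + 2)
      = - \<phi> (t - \<delta>) + elog (ereal (real (card N))) + 0 + 2"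
    using n \<alpha> by (simp add: elog_def)
  also have "\<dots> \<le> - \<phi> (t - \<delta>) + elog (ereal (real (card N)))
      + elog (max (ereal \<kappa> * ereal L * D / ereal \<delta>) 1) + 2"
    by (intro add_mono order_refl elog_nonneg) simp
  finally show ?thesis by (simp add: P_def)
qed

end
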